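(* Let $n\ge2$. Let $h=(h_1,\dots,h_n)\colon\overline U\to\mathbb{C}^n$ be a continuous map which is holomorphic in $U$, and let $0<r<1$ be such that the components $h_j$ have no zeros in $\{\zeta: r\le|\zeta|\le1\}$. Then for each $\epsilon>0$ there exists a proper holomorphic map $f=(f_1,\dots,f_n)\colon U\to\mathbb{C}^n$ such that the components $f_j$ have no zeros in $\{\zeta: r\le|\zeta|<1\}$ and $|f(\zeta)-h(\zeta)|<\epsilon$ for $|\zeta|\le r$.
   Context: $U=\{\zeta\in\mathbb{C}:|\zeta|<1\}$ is the open unit disc and $\overline U$ its closure. Proper means $|f(\zeta)|\to\infty$ as $|\zeta|\to1$. *)

theory Defs
  imports "HOL-Complex_Analysis.Complex_Analysis"
begin

definition holomorphic_map_on :: "(complex \<Rightarrow> complex ^ 'n) \<Rightarrow> complex set \<Rightarrow> bool"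
    (infixl "holomorphic'_map'_on" 50)
  where "f holomorphic_map_on S \<longleftrightarrow> (\<forall>j. (\<lambda>z. f z $ j) holomorphic_on S)"

text \<open>The filter \<open>filtercomap norm (at_left 1)\<close> describes \<open>norm z\<close> tending to 1 from inside
  the open unit disc, uniformly in the argument of \<open>z\<close>.\<close>

definition proper_on_disc :: "(complex \<Rightarrow> complex ^ 'n) \<Rightarrow> bool"
  where "proper_on_disc f \<longleftrightarrow>
    filterlim (\<lambda>z. norm (f z)) at_top (filtercomap norm (at_left 1))"

end

theory Submission
  imports Defs
begin

text \<open>
  The map is sought in the form \<open>f\<^sub>j = h\<^sub>j exp(G\<^sub>j)\<close> with \<open>G\<^sub>j\<close> holomorphic on the open unit disc.
  Multiplying by exponentials creates no zeros, and the moduli of the \<open>h\<^sub>j\<close> are bounded below by a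
  positive constant on the compact annulus \<open>r \<le> |z| \<le> 1\<close>. So it suffices to let each \<open>G\<^sub>j\<close> be
  one of two functions \<open>g\<^sub>1\<close>, \<open>g\<^sub>2\<close> that are small on \<open>|z| \<le> r\<close> and satisfy
  \<open>max (Re g\<^sub>1) (Re g\<^sub>2) \<rightarrow> \<infinity>\<close> at the unit circle; both occur because there are at least two
  components. This is the lemma \<open>small_pair_with_large_max_Re\<close>.

  The pair is the limit of pairs of entire functions \<open>(F, G)\<close> with
  \<open>max (Re F) (Re G) \<ge> n\<close> on the circle. The inductive step (\<open>lift_boundary\<close>) must raise this
  bound by one without lowering the maximum noticeably on the annulus between the place where
  \<open>F\<close>, \<open>G\<close> have hardly been changed and the circle. By the mean value
  property a single harmonic function cannot tend to infinity at the circle, but the maximum of two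
  can, since each may be very negative where the other is large. Put
  \<open>F' = F + a \<xi> - d \<xi>\<^sup>2\<close> and \<open>G' = G - b \<xi> - d \<xi>\<^sup>2\<close> with \<open>\<xi> = z\<^sup>N\<close>, \<open>N\<close> huge, and positive slopes
  \<open>a\<close>, \<open>b\<close>. Where \<open>Re \<xi> \<ge> 0\<close> the term \<open>a \<xi>\<close> helps \<open>F\<close>, and where \<open>Re \<xi> \<le> 0\<close> the term \<open>- b \<xi>\<close> helps
  \<open>G\<close>; near the line \<open>Re \<xi> = 0\<close>, where neither helps, the term \<open>- d \<xi>\<^sup>2\<close> has real part about
  \<open>d (Im \<xi>)\<^sup>2\<close>, which raises both functions and is close to \<open>d\<close> when \<open>|\<xi>| = 1\<close>. If one of the
  two functions lies below the level \<open>n\<close>, then it has to overtake the other as soon as \<open>\<xi>\<close>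
  enters its half of the disc; hence its slope must be large, in proportion to its deficit
  (\<open>lift_over_disc\<close>).

  The slopes are then only continuous functions of \<open>z\<close>. On the circle they are uniform limits of
  Laurent polynomials, by Stone--Weierstrass, and the factor \<open>z\<^sup>N\<close> absorbs the negative powers
  (\<open>entire_approximation_on_circle\<close>). The same factor makes the change negligible on any fixed
  smaller disc, so a telescoping sum of these changes converges locally uniformly.
\<close>

section \<open>Raising the larger of two real parts over a disc\<close>

text \<open>
  Here \<open>x\<close> and \<open>y\<close> are the real and imaginary parts of \<open>\<xi>\<close>, and \<open>u\<close> is the function that reaches
  the level \<open>\<kappa>\<close>. On the right half of the disc \<open>u\<close> is raised, since \<open>2 x - x\<^sup>2 + y\<^sup>2\<close> is
  nonnegative there and at least \<open>1\<close> on the circle. For \<open>x \<le> - 1 / L\<close> the steep slope of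
  \<open>v\<close> has made good its deficit, and the same estimate applies to \<open>v\<close>. In the strip between, \<open>u\<close> is
  still used, and its loss is of order \<open>d / L\<close>.
\<close>

lemma lift_over_disc_aux:
  fixes u v \<kappa> d L x y :: real
  assumes "x\<^sup>2 + y\<^sup>2 \<le> 1" "0 < d" "1 \<le> L" "\<kappa> \<le> u"
  defines "b \<equiv> 2 * d + L * max 0 (\<kappa> - v)"
  defines "M \<equiv> max (u + 2 * d * x - d * (x\<^sup>2 - y\<^sup>2)) (v - b * x - d * (x\<^sup>2 - y\<^sup>2))"
  shows "\<kappa> - 4 * d / L \<le> M"
    and "x\<^sup>2 + y\<^sup>2 = 1 \<Longrightarrow> \<kappa> + d - 4 * d / L \<le> M"
proof -
  \<comment> \<open>The factor \<open>s\<close> records whether the gain \<open>d\<close> is claimed, so that both parts have one proof.\<close>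
  define s where "s = (if x\<^sup>2 + y\<^sup>2 = 1 then 1 else 0 :: real)"
  have dL: "0 \<le> 4 * d / L" using assms by simp
  have "x\<^sup>2 \<le> 1"
    using assms(1) zero_le_power2[of y] by linarith
  then have x1: "\<bar>x\<bar> \<le> 1"
    using abs_square_le_1 by blast
  have xx: "x\<^sup>2 \<le> \<bar>x\<bar>"
    using mult_right_mono[OF x1, of "\<bar>x\<bar>"] by (simp add: power2_eq_square)
  have sq: "2 * \<bar>x\<bar> - x\<^sup>2 + y\<^sup>2 \<ge> s"
  proof (cases "x\<^sup>2 + y\<^sup>2 = 1")
    case True then show ?thesis using xx by (simp add: s_def)
  next
    case False
    have "0 \<le> \<bar>x\<bar>" "0 \<le> y\<^sup>2" by simp_all
    then show ?thesis using False xx unfolding s_def by (simp)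
  qed
  have dsq: "d * s \<le> d * (2 * \<bar>x\<bar> - x\<^sup>2 + y\<^sup>2)"
    using sq \<open>0 < d\<close> by (intro mult_left_mono) auto
  have "\<kappa> + d * s - 4 * d / L \<le> M"
  proof -
    consider "x \<ge> 0" | "x < 0" "\<bar>x\<bar> < 1 / L" | "x < 0" "\<bar>x\<bar> \<ge> 1 / L" by linarith
    then show ?thesis
    proof cases
      case 1
      then have "\<kappa> + d * s \<le> u + 2 * d * x - d * (x\<^sup>2 - y\<^sup>2)"
        using dsq \<open>\<kappa> \<le> u\<close> by (simp add: algebra_simps)
      then show ?thesis unfolding M_def using dL by linarith
    next
      case 2
      have "4 * d * \<bar>x\<bar> \<le> 4 * d * (1 / L)"
        using 2 \<open>0 < d\<close> by (intro mult_left_mono) auto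
      then have "\<kappa> + d * s - 4 * d / L \<le> u + 2 * d * x - d * (x\<^sup>2 - y\<^sup>2)"
        using dsq \<open>\<kappa> \<le> u\<close> 2 by (simp add: algebra_simps)
      then show ?thesis unfolding M_def by linarith
    next
      case 3
      have "L * \<bar>x\<bar> \<ge> 1" using 3 \<open>1 \<le> L\<close> by (simp add: field_simps)
      then have "max 0 (\<kappa> - v) * 1 \<le> max 0 (\<kappa> - v) * (L * \<bar>x\<bar>)"
        by (intro mult_left_mono) auto
      then have "2 * d * \<bar>x\<bar> + (\<kappa> - v) \<le> - b * x"
        using 3 unfolding b_def by (simp add: algebra_simps)
      then have "\<kappa> + d * s \<le> v - b * x - d * (x\<^sup>2 - y\<^sup>2)"
        using dsq by (simp add: algebra_simps)
      then show ?thesis unfolding M_def using dL by linarith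
    qed
  qed
  then show "x\<^sup>2 + y\<^sup>2 = 1 \<Longrightarrow> \<kappa> + d - 4 * d / L \<le> M"
    by (simp add: s_def)
  have "d * s \<ge> 0" using \<open>0 < d\<close> by (simp add: s_def)
  then show "\<kappa> - 4 * d / L \<le> M"
    using \<open>\<kappa> + d * s - 4 * d / L \<le> M\<close> by linarith
qed

text \<open>
  The two functions play symmetric roles: \<open>\<xi> \<mapsto> - \<xi>\<close> exchanges them. A function at or above the
  level \<open>\<kappa>\<close> gets the basic slope \<open>2 * d\<close>, one below it an excess slope proportional to its
  deficit; this makes the slopes depend continuously on \<open>u\<close> and \<open>v\<close>. The loss \<open>4 * d / L\<close> is
  made harmless by a large \<open>L\<close>.
\<close>

lemma lift_over_disc:
  fixes u v \<kappa> d L :: real and \<xi> :: complex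
  assumes "norm \<xi> \<le> 1" "0 < d" "1 \<le> L" "\<kappa> \<le> max u v"
  defines "a \<equiv> 2 * d + L * max 0 (\<kappa> - u)" and "b \<equiv> 2 * d + L * max 0 (\<kappa> - v)"
  defines "M \<equiv> max (u + Re (a * \<xi> - d * \<xi>\<^sup>2)) (v + Re (- b * \<xi> - d * \<xi>\<^sup>2))"
  shows "\<kappa> - 4 * d / L \<le> M"
    and "norm \<xi> = 1 \<Longrightarrow> \<kappa> + d - 4 * d / L \<le> M"
proof -
  obtain x y where \<xi>: "\<xi> = Complex x y" by (cases \<xi>)
  have n: "(norm \<xi>)\<^sup>2 = x\<^sup>2 + y\<^sup>2" by (simp add: \<xi> cmod_power2)
  have le: "x\<^sup>2 + y\<^sup>2 \<le> 1"
    using assms(1) by (simp flip: n add: abs_square_le_1)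
  have eq: "x\<^sup>2 + y\<^sup>2 = 1" if "norm \<xi> = 1"
    using that n by simp
  have M: "M = max (u + a * x - d * (x\<^sup>2 - y\<^sup>2)) (v - b * x - d * (x\<^sup>2 - y\<^sup>2))"
    by (simp add: M_def \<xi> power2_eq_square)
  have "\<kappa> - 4 * d / L \<le> M \<and> (norm \<xi> = 1 \<longrightarrow> \<kappa> + d - 4 * d / L \<le> M)"
  proof (cases "\<kappa> \<le> u")
    case True
    then have "a = 2 * d" by (simp add: a_def)
    then show ?thesis
      using lift_over_disc_aux[OF le assms(2,3) True, of v] eq unfolding M b_def by simp
  next
    case False
    then have v: "\<kappa> \<le> v" using assms(4) by linarith
    then have "b = 2 * d" by (simp add: b_def)
    then show ?thesis
      using lift_over_disc_aux[of "- x" y, OF _ assms(2,3) v, of u] le eq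
      unfolding M a_def by (simp add: max.commute)
  qed
  then show "\<kappa> - 4 * d / L \<le> M" "norm \<xi> = 1 \<Longrightarrow> \<kappa> + d - 4 * d / L \<le> M"
    by auto
qed

section \<open>Continuous functions on the circle and entire functions\<close>

text \<open>
  On the unit circle \<open>cnj z = 1 / z\<close>, so \<open>Re z\<close> and \<open>Im z\<close>, and therefore all real polynomials in
  them, are Laurent polynomials in \<open>z\<close>. The power \<open>z ^ m\<close> clears the negative exponents.
\<close>

lemma real_polynomial_function_times_power_entire:
  fixes g :: "complex \<Rightarrow> real"
  assumes "real_polynomial_function g"
  shows "\<exists>P m. P holomorphic_on UNIV \<and> (\<forall>z. norm z = 1 \<longrightarrow> P z = z ^ m * g z)"
  using assms
proof induction
  case (linear f)
  interpret f: bounded_linear f by fact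
  have f: "f z = Re z * f 1 + Im z * f \<i>" for z
  proof -
    have "z = Re z *\<^sub>R 1 + Im z *\<^sub>R \<i>" by (simp add: complex_eq_iff)
    then have "f z = f (Re z *\<^sub>R 1 + Im z *\<^sub>R \<i>)" by simp
    then show ?thesis by (simp only: f.add f.scaleR real_scaleR_def)
  qed
  define P where "P = (\<lambda>z::complex. (z\<^sup>2 + 1) / 2 * f 1 + (z\<^sup>2 - 1) / (2 * \<i>) * f \<i>)"
  have "P z = z ^ 1 * f z" if "norm z = 1" for z
  proof -
    have 1: "z * cnj z = 1"
      using complex_norm_square[of z] that by simp
    have "Re z = (z + cnj z) / 2" "Im z = (z - cnj z) / (2 * \<i>)"
      by (simp_all add: complex_eq_iff)
    then have "of_real (f z) = (z + cnj z) / 2 * f 1 + (z - cnj z) / (2 * \<i>) * f \<i>"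
      by (simp only: f[of z] of_real_add of_real_mult)
    then have "z ^ 1 * f z = z * ((z + cnj z) / 2 * f 1 + (z - cnj z) / (2 * \<i>) * f \<i>)"
      by simp
    also have "\<dots> = (z\<^sup>2 + z * cnj z) / 2 * f 1 + (z\<^sup>2 - z * cnj z) / (2 * \<i>) * f \<i>"
      by (simp add: field_simps power2_eq_square)
    finally have "z ^ 1 * f z = (z\<^sup>2 + z * cnj z) / 2 * f 1 + (z\<^sup>2 - z * cnj z) / (2 * \<i>) * f \<i>" .
    then show ?thesis by (simp only: 1 P_def)
  qed
  moreover have "P holomorphic_on UNIV"
    unfolding P_def by (intro holomorphic_intros) auto
  ultimately show ?case by blast
next
  case (const c)
  have "(\<lambda>z. of_real c) holomorphic_on UNIV" by simp
  moreover have "\<forall>z. norm z = 1 \<longrightarrow> of_real c = z ^ 0 * of_real c" by simp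
  ultimately show ?case by blast
next
  case (add f g)
  then obtain P m Q n where *: "P holomorphic_on UNIV" "Q holomorphic_on UNIV"
    "\<And>z. norm z = 1 \<Longrightarrow> P z = z ^ m * f z" "\<And>z. norm z = 1 \<Longrightarrow> Q z = z ^ n * g z"
    by metis
  have "(\<lambda>z. z ^ n * P z + z ^ m * Q z) holomorphic_on UNIV"
    by (intro holomorphic_intros *)
  moreover have "\<forall>z. norm z = 1 \<longrightarrow> z ^ n * P z + z ^ m * Q z = z ^ (m + n) * of_real (f z + g z)"
    by (simp add: * power_add algebra_simps)
  ultimately show ?case by (intro exI conjI)
next
  case (mult f g)
  then obtain P m Q n where *: "P holomorphic_on UNIV" "Q holomorphic_on UNIV"
    "\<And>z. norm z = 1 \<Longrightarrow> P z = z ^ m * f z" "\<And>z. norm z = 1 \<Longrightarrow> Q z = z ^ n * g z"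
    by metis
  have "(\<lambda>z. P z * Q z) holomorphic_on UNIV"
    by (intro holomorphic_intros *)
  moreover have "\<forall>z. norm z = 1 \<longrightarrow> P z * Q z = z ^ (m + n) * of_real (f z * g z)"
    by (simp add: * power_add algebra_simps)
  ultimately show ?case by (intro exI conjI)
qed

lemma entire_approximation_on_circle:
  fixes a :: "complex \<Rightarrow> real"
  assumes "continuous_on (sphere 0 1) a" "0 < \<eta>"
  obtains P m where "P holomorphic_on UNIV" "\<And>z. norm z = 1 \<Longrightarrow> norm (P z - z ^ m * a z) < \<eta>"
proof -
  obtain g where g: "real_polynomial_function g" "\<And>z. z \<in> sphere 0 1 \<Longrightarrow> \<bar>a z - g z\<bar> < \<eta>"
    using Stone_Weierstrass_real_polynomial_function[OF compact_sphere assms] by blast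
  obtain P m where P: "P holomorphic_on UNIV" "\<And>z. norm z = 1 \<Longrightarrow> P z = z ^ m * g z"
    using real_polynomial_function_times_power_entire[OF g(1)] by metis
  have "norm (P z - z ^ m * a z) < \<eta>" if "norm z = 1" for z
  proof -
    have "P z - z ^ m * a z = z ^ m * of_real (g z - a z)"
      using P(2)[OF that] by (simp add: algebra_simps)
    then have "norm (P z - z ^ m * a z) = \<bar>g z - a z\<bar>"
      using that by (simp add: norm_mult norm_power del: of_real_diff)
    then show ?thesis using g(2)[of z] that by (simp add: abs_minus_commute)
  qed
  with P(1) that show ?thesis by blast
qed

text \<open>
  Strict inequalities between continuous functions that hold on the circle persist on a closed
  annulus of positive width.
\<close>

lemma annulus_in_open_nhd_of_circle:
  fixes S :: "complex set"
  assumes "open S" "sphere 0 1 \<subseteq> S" "\<rho> < 1"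
  obtains \<sigma> where "\<rho> < \<sigma>" "\<sigma> < 1" "\<And>z. \<sigma> \<le> norm z \<Longrightarrow> norm z \<le> 1 \<Longrightarrow> z \<in> S"
proof -
  define K where "K = cball 0 1 - S"
  have "compact K" unfolding K_def using assms(1) by (intro compact_diff) auto
  have "\<exists>\<tau><1. \<forall>z\<in>K. norm z \<le> \<tau>"
  proof (cases "K = {}")
    case True then show ?thesis by (intro exI[of _ 0]) auto
  next
    case False
    obtain w where w: "w \<in> K" "\<forall>z\<in>K. norm z \<le> norm w"
      using continuous_attains_sup[OF \<open>compact K\<close> False, of norm] by (auto intro: continuous_intros)
    have "norm w < 1" using w(1) assms(2) unfolding K_def by force
    with w show ?thesis by blast
  qed
  then obtain \<tau> where \<tau>: "\<tau> < 1" "\<forall>z\<in>K. norm z \<le> \<tau>" by blast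
  obtain \<sigma> where "max \<rho> \<tau> < \<sigma>" "\<sigma> < 1"
    using dense[of "max \<rho> \<tau>" 1] assms(3) \<tau>(1) by auto
  with \<tau>(2) that[of \<sigma>] show ?thesis unfolding K_def by force
qed

section \<open>The inductive step\<close>

text \<open>
  The construction of \<open>lift_over_disc\<close> is applied at every point \<open>z\<close> near the circle with
  \<open>\<xi> = z ^ (m + k + n)\<close>. The radius \<open>\<sigma>\<close> is chosen before \<open>n\<close>: on \<open>\<sigma> \<le> |z| \<le> 1\<close> the estimates
  for the approximated slopes hold for all \<open>n\<close>, because multiplication by powers of \<open>z\<close>
  does not increase errors, while on \<open>|z| \<le> \<sigma>\<close> everything added contains the factor \<open>z ^ n\<close> and
  becomes small as \<open>n\<close> grows.
\<close>

lemma lift_boundary: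
  fixes F G :: "complex \<Rightarrow> complex" and \<kappa> \<epsilon> \<rho> :: real
  assumes hol: "F holomorphic_on UNIV" "G holomorphic_on UNIV"
    and max: "\<And>z. norm z = 1 \<Longrightarrow> \<kappa> \<le> max (Re (F z)) (Re (G z))"
    and "0 < \<epsilon>" "\<rho> < 1"
  obtains F' G' \<sigma> where "F' holomorphic_on UNIV" "G' holomorphic_on UNIV" "\<rho> < \<sigma>" "\<sigma> < 1"
    "\<And>z. norm z \<le> \<sigma> \<Longrightarrow> norm (F' z - F z) < \<epsilon> \<and> norm (G' z - G z) < \<epsilon>"
    "\<And>z. \<sigma> \<le> norm z \<Longrightarrow> norm z \<le> 1 \<Longrightarrow> \<kappa> - \<epsilon> \<le> max (Re (F' z)) (Re (G' z))"
    "\<And>z. norm z = 1 \<Longrightarrow> \<kappa> + 1 \<le> max (Re (F' z)) (Re (G' z))"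
proof -
  \<comment> \<open>An error \<open>\<eta>\<close> is incurred three times: in the level reached near the circle, through the finite
    \<open>L\<close>, and in approximating the slopes. With \<open>d = 2\<close> a gain of at least \<open>1\<close> remains.\<close>
  define \<eta> where "\<eta> = min \<epsilon> 1 / 3"
  have \<eta>: "0 < \<eta>" "3 * \<eta> \<le> \<epsilon>" "3 * \<eta> \<le> 1" using \<open>0 < \<epsilon>\<close> by (auto simp: \<eta>_def)
  define L where "L = 8 / \<eta>"
  have L: "1 \<le> L" "4 * 2 / L = \<eta>" using \<eta> by (auto simp: L_def field_simps)
  define slope where "slope = (\<lambda>t. 2 * 2 + L * max 0 (\<kappa> - \<eta> - t))"
  have contF: "continuous_on S F" and contG: "continuous_on S G" for S
    using hol by (auto intro: holomorphic_on_imp_continuous_on holomorphic_on_subset)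
  have contsl: "continuous_on S (\<lambda>z. slope (Re (F z)))" "continuous_on S (\<lambda>z. slope (Re (G z)))" for S
    unfolding slope_def by (intro continuous_intros contF contG)+
  obtain P m where P: "P holomorphic_on UNIV"
      "\<And>z. norm z = 1 \<Longrightarrow> norm (P z - z ^ m * slope (Re (F z))) < \<eta>"
    using entire_approximation_on_circle[OF contsl(1) \<open>0 < \<eta>\<close>] by blast
  obtain Q k where Q: "Q holomorphic_on UNIV"
      "\<And>z. norm z = 1 \<Longrightarrow> norm (Q z - z ^ k * slope (Re (G z))) < \<eta>"
    using entire_approximation_on_circle[OF contsl(2) \<open>0 < \<eta>\<close>] by blast
  have contP: "continuous_on S P" and contQ: "continuous_on S Q" for S
    using P(1) Q(1) by (auto intro: holomorphic_on_imp_continuous_on holomorphic_on_subset)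
  define S where "S = {z. \<kappa> - \<eta> < max (Re (F z)) (Re (G z)) \<and>
      norm (P z - z ^ m * slope (Re (F z))) < \<eta> \<and> norm (Q z - z ^ k * slope (Re (G z))) < \<eta>}"
  have "open S"
    unfolding S_def by (intro open_Collect_conj open_Collect_less continuous_intros contF contG contP contQ contsl)
  moreover have "sphere 0 1 \<subseteq> S"
  proof
    fix z :: complex assume "z \<in> sphere 0 1"
    then have "norm z = 1" by simp
    from max[OF this] P(2)[OF this] Q(2)[OF this] \<eta>(1) show "z \<in> S"
      unfolding S_def by simp
  qed
  ultimately obtain \<sigma> where \<sigma>: "max \<rho> 0 < \<sigma>" "\<sigma> < 1" "\<And>z. \<sigma> \<le> norm z \<Longrightarrow> norm z \<le> 1 \<Longrightarrow> z \<in> S"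
    using annulus_in_open_nhd_of_circle[of S "max \<rho> 0"] \<open>\<rho> < 1\<close> by auto
  have "bounded (P ` cball 0 1)" "bounded (Q ` cball 0 1)"
    by (intro compact_imp_bounded compact_continuous_image contP contQ compact_cball)+
  then obtain B C where B: "\<And>z. norm z \<le> 1 \<Longrightarrow> norm (P z) \<le> B" and C: "\<And>z. norm z \<le> 1 \<Longrightarrow> norm (Q z) \<le> C"
    unfolding bounded_iff by (metis image_eqI mem_cball_0)
  define D where "D = max B C + 2"
  have "D > 0" using B[of 0] norm_ge_zero[of "P 0"] unfolding D_def by (smt (verit) norm_zero)
  have "(\<lambda>n. D * \<sigma> ^ n) \<longlonglongrightarrow> D * 0"
    using \<sigma> by (intro tendsto_mult tendsto_const LIMSEQ_realpow_zero) auto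
  then have "eventually (\<lambda>n. D * \<sigma> ^ n < \<epsilon>) sequentially"
    using \<open>0 < \<epsilon>\<close> by (intro order_tendstoD) auto
  then obtain n where n: "D * \<sigma> ^ n < \<epsilon>"
    using eventually_happens' sequentially_bot by blast
  \<comment> \<open>Since \<open>P\<close> approximates \<open>z ^ m\<close> times the first slope, the term \<open>P z * z ^ (k + n)\<close> approximates the
    slope times \<open>\<xi> z\<close>; likewise for \<open>Q\<close>.\<close>
  define \<xi> where "\<xi> = (\<lambda>z::complex. z ^ (m + k + n))"
  define F' where "F' = (\<lambda>z. F z + (P z * z ^ (k + n) - 2 * (\<xi> z)\<^sup>2))"
  define G' where "G' = (\<lambda>z. G z + (- Q z * z ^ (m + n) - 2 * (\<xi> z)\<^sup>2))"
  have small: "norm (R * z ^ (j + n) - 2 * (\<xi> z)\<^sup>2) < \<epsilon>"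
    if "norm z \<le> \<sigma>" "norm R \<le> max B C" for R z j
  proof -
    have z1: "norm z \<le> 1" using that \<sigma> by simp
    have p: "norm z ^ i \<le> norm z ^ n" if "n \<le> i" for i
      using z1 that by (intro power_decreasing) auto
    have "norm (R * z ^ (j + n) - 2 * (\<xi> z)\<^sup>2) \<le> norm R * norm z ^ (j + n) + 2 * norm z ^ ((m + k + n) * 2)"
      unfolding \<xi>_def by (intro order_trans[OF norm_triangle_ineq4]) (simp add: norm_mult norm_power flip: power_mult)
    also have "\<dots> \<le> max B C * norm z ^ n + 2 * norm z ^ n"
      using that(2) by (intro add_mono mult_mono p) (auto intro: order_trans[OF norm_ge_zero])
    also have "\<dots> = D * norm z ^ n" by (simp add: D_def algebra_simps)
    also have "\<dots> \<le> D * \<sigma> ^ n"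
      using that \<open>D > 0\<close> by (intro mult_left_mono power_mono) auto
    finally show ?thesis using n by linarith
  qed
  have near: "Re (F' z) \<ge> Re (F z) + Re (slope (Re (F z)) * \<xi> z - 2 * (\<xi> z)\<^sup>2) - \<eta>"
             "Re (G' z) \<ge> Re (G z) + Re (- slope (Re (G z)) * \<xi> z - 2 * (\<xi> z)\<^sup>2) - \<eta>"
    if "z \<in> S" "norm z \<le> 1" for z
  proof -
    have le: "norm (w * z ^ j) \<le> \<eta>" if "norm w < \<eta>" for w :: complex and j
    proof -
      have "norm z ^ j \<le> 1" using \<open>norm z \<le> 1\<close> by (simp add: power_le_one)
      then have "norm w * norm z ^ j \<le> \<eta> * 1"
        using that \<eta> by (intro mult_mono) auto
      then show ?thesis by (simp add: norm_mult norm_power)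
    qed
    have "norm ((P z - z ^ m * slope (Re (F z))) * z ^ (k + n)) \<le> \<eta>"
      using that by (intro le) (simp add: S_def)
    moreover have "(P z - z ^ m * slope (Re (F z))) * z ^ (k + n)
        = F' z - (F z + (slope (Re (F z)) * \<xi> z - 2 * (\<xi> z)\<^sup>2))"
      by (simp add: F'_def \<xi>_def power_add algebra_simps)
    ultimately show "Re (F' z) \<ge> Re (F z) + Re (slope (Re (F z)) * \<xi> z - 2 * (\<xi> z)\<^sup>2) - \<eta>"
      using abs_Re_le_cmod[of "F' z - (F z + (slope (Re (F z)) * \<xi> z - 2 * (\<xi> z)\<^sup>2))"] by simp
    have "norm ((Q z - z ^ k * slope (Re (G z))) * z ^ (m + n)) \<le> \<eta>"
      using that by (intro le) (simp add: S_def)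
    moreover have "(Q z - z ^ k * slope (Re (G z))) * z ^ (m + n)
        = (G z + (- slope (Re (G z)) * \<xi> z - 2 * (\<xi> z)\<^sup>2)) - G' z"
      by (simp add: G'_def \<xi>_def power_add algebra_simps)
    ultimately show "Re (G' z) \<ge> Re (G z) + Re (- slope (Re (G z)) * \<xi> z - 2 * (\<xi> z)\<^sup>2) - \<eta>"
      using abs_Re_le_cmod[of "(G z + (- slope (Re (G z)) * \<xi> z - 2 * (\<xi> z)\<^sup>2)) - G' z"] by simp
  qed
  have \<xi>1: "norm (\<xi> z) \<le> 1" if "norm z \<le> 1" for z
    using that by (simp add: \<xi>_def norm_power power_le_one)
  show ?thesis
  proof (rule that[of F' G' \<sigma>])
    show "F' holomorphic_on UNIV" "G' holomorphic_on UNIV"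
      unfolding F'_def G'_def \<xi>_def by (intro holomorphic_intros hol P Q)+
    show "\<rho> < \<sigma>" "\<sigma> < 1" using \<sigma> by auto
    show "norm (F' z - F z) < \<epsilon> \<and> norm (G' z - G z) < \<epsilon>" if "norm z \<le> \<sigma>" for z
    proof -
      have "norm z \<le> 1" using that \<sigma> by simp
      then have "norm (P z) \<le> max B C" "norm (- Q z) \<le> max B C"
        using B[of z] C[of z] by auto
      from small[OF that this(1), of k] small[OF that this(2), of m] show ?thesis
        by (simp add: F'_def G'_def)
    qed
    show "\<kappa> - \<epsilon> \<le> max (Re (F' z)) (Re (G' z))" if "\<sigma> \<le> norm z" "norm z \<le> 1" for z
    proof -
      have S: "z \<in> S" using \<sigma>(3) that by blast
      then have "\<kappa> - \<eta> \<le> max (Re (F z)) (Re (G z))" by (simp add: S_def)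
      from lift_over_disc(1)[OF \<xi>1[OF that(2)] _ L(1) this, of 2] near[OF S that(2)] \<eta>(2)
      show ?thesis unfolding L(2) slope_def by simp
    qed
    show "\<kappa> + 1 \<le> max (Re (F' z)) (Re (G' z))" if "norm z = 1" for z
    proof -
      have S: "z \<in> S" and z1: "norm z \<le> 1" using \<sigma> that by auto
      then have "\<kappa> - \<eta> \<le> max (Re (F z)) (Re (G z))" by (simp add: S_def)
      moreover have "norm (\<xi> z) = 1" using that by (simp add: \<xi>_def norm_power)
      ultimately show ?thesis
        using lift_over_disc(2)[OF \<xi>1[OF z1] _ L(1), of 2 "\<kappa> - \<eta>" "Re (F z)" "Re (G z)"]
          near[OF S z1] \<eta>(3)
        unfolding L(2) slope_def by simp
    qed
  qed
qed

section \<open>Passing to the limit\<close>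

text \<open>
  The index shift in the conclusion is natural: on \<open>|z| \<le> \<sigma> (Suc n)\<close> all increments from the
  \<open>n\<close>-th one on are controlled, and they sum to at most \<open>\<gamma> / 2 ^ n\<close>.
\<close>

lemma telescoping_locally_uniform_limit:
  fixes F :: "nat \<Rightarrow> complex \<Rightarrow> complex" and \<sigma> :: "nat \<Rightarrow> real"
  assumes hol: "\<And>n. F n holomorphic_on UNIV"
    and \<gamma>: "0 \<le> \<gamma>"
    and \<sigma>: "mono \<sigma>" "\<And>n. \<sigma> n < 1" "\<sigma> \<longlonglongrightarrow> 1"
    and step: "\<And>n z. norm z \<le> \<sigma> (Suc n) \<Longrightarrow> norm (F (Suc n) z - F n z) \<le> \<gamma> / 2 ^ Suc n"
  obtains g where "g holomorphic_on ball 0 1"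
    "\<And>n z. norm z \<le> \<sigma> (Suc n) \<Longrightarrow> norm (g z - F n z) \<le> \<gamma> / 2 ^ n"
proof -
  have diff: "norm (F (n + j) z - F n z) \<le> \<gamma> / 2 ^ n - \<gamma> / 2 ^ (n + j)" if z: "norm z \<le> \<sigma> (Suc n)" for n j z
  proof (induction j)
    case (Suc j)
    have "\<sigma> (Suc n) \<le> \<sigma> (Suc (n + j))" using \<sigma>(1) by (auto simp: mono_def)
    then have "norm (F (Suc (n + j)) z - F (n + j) z) \<le> \<gamma> / 2 ^ Suc (n + j)"
      using z by (intro step) simp
    moreover have "norm (F (n + Suc j) z - F n z)
        \<le> norm (F (Suc (n + j)) z - F (n + j) z) + norm (F (n + j) z - F n z)"
      using norm_triangle_ineq[of "F (Suc (n + j)) z - F (n + j) z" "F (n + j) z - F n z"] by simp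
    moreover have "\<gamma> / 2 ^ (n + j) = 2 * (\<gamma> / 2 ^ Suc (n + j))" by simp
    ultimately show ?case using Suc by simp
  qed simp
  have ev: "\<exists>n. x < \<sigma> (Suc n)" if "x < 1" for x
  proof -
    have "eventually (\<lambda>n. x < \<sigma> n) sequentially" using \<sigma>(3) that by (intro order_tendstoD)
    then obtain n where "x < \<sigma> n" using eventually_happens' sequentially_bot by blast
    moreover have "\<sigma> n \<le> \<sigma> (Suc n)" using \<sigma>(1) by (auto simp: mono_def)
    ultimately show ?thesis by (metis less_le_trans)
  qed
  have lim0: "(\<lambda>n. \<gamma> / 2 ^ n) \<longlonglongrightarrow> 0"
    using LIMSEQ_divide_realpow_zero[of 2 \<gamma>] by simp
  have tail: "norm (F i z - F n z) \<le> \<gamma> / 2 ^ n" if "norm z \<le> \<sigma> (Suc n)" "n \<le> i" for n i z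
    using diff[OF that(1), of "i - n"] that(2) \<gamma> by (auto intro: order_trans)
  have conv: "convergent (\<lambda>n. F n z)" if z1: "norm z < 1" for z
  proof -
    obtain m where m: "norm z < \<sigma> (Suc m)" using ev[OF z1] by blast
    have "Cauchy (\<lambda>n. F n z)"
    proof (rule metric_CauchyI)
      fix e :: real assume "0 < e"
      then obtain M where M: "\<And>n. n \<ge> M \<Longrightarrow> \<gamma> / 2 ^ n < e / 2"
        using order_tendstoD(2)[OF lim0, of "e / 2"]
        by (auto simp: eventually_sequentially)
      define N where "N = max M m"
      have "\<sigma> (Suc m) \<le> \<sigma> (Suc N)" using \<sigma>(1) by (auto simp: mono_def N_def)
      then have *: "dist (F i z) (F N z) < e / 2" if "i \<ge> N" for i
      proof -
        have "norm (F i z - F N z) \<le> \<gamma> / 2 ^ N"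
          using m that \<open>\<sigma> (Suc m) \<le> \<sigma> (Suc N)\<close> by (intro tail) auto
        also have "\<dots> < e / 2" by (rule M) (simp add: N_def)
        finally show ?thesis by (simp add: dist_norm)
      qed
      show "\<exists>N. \<forall>i\<ge>N. \<forall>j\<ge>N. dist (F i z) (F j z) < e"
        using * dist_triangle_half_l by blast
    qed
    then show ?thesis by (simp add: Cauchy_convergent_iff)
  qed
  define g where "g = (\<lambda>z. lim (\<lambda>n. F n z))"
  have glim: "(\<lambda>n. F n z) \<longlonglongrightarrow> g z" if "norm z < 1" for z
    using conv[OF that] by (simp add: g_def convergent_LIMSEQ_iff)
  have close: "norm (g z - F n z) \<le> \<gamma> / 2 ^ n" if z: "norm z \<le> \<sigma> (Suc n)" for n z
  proof (rule Lim_norm_ubound)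
    have "norm z < 1" using z \<sigma>(2)[of "Suc n"] by simp
    then show "(\<lambda>i. F i z - F n z) \<longlonglongrightarrow> g z - F n z" by (intro tendsto_intros glim)
    show "eventually (\<lambda>i. norm (F i z - F n z) \<le> \<gamma> / 2 ^ n) sequentially"
      using eventually_ge_at_top[of n] by eventually_elim (rule tail[OF z])
  qed simp
  have "g holomorphic_on ball 0 1"
  proof (rule holomorphic_uniform_sequence)
    show "F n holomorphic_on ball 0 1" for n using hol holomorphic_on_subset by blast
    fix x :: complex assume "x \<in> ball 0 1"
    then obtain m where m: "norm x < \<sigma> (Suc m)" using ev[of "norm x"] by auto
    define d where "d = \<sigma> (Suc m) - norm x"
    have nz: "norm z \<le> \<sigma> (Suc m)" if "z \<in> cball x d" for z
      using that norm_triangle_ineq2[of z x] by (simp add: d_def dist_norm norm_minus_commute)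
    have "uniform_limit (cball x d) F g sequentially"
    proof (rule uniform_limitI)
      fix e :: real assume "0 < e"
      with lim0 have "eventually (\<lambda>n. \<gamma> / 2 ^ n < e) sequentially" by (intro order_tendstoD)
      with eventually_ge_at_top[of m]
      show "eventually (\<lambda>n. \<forall>z\<in>cball x d. dist (F n z) (g z) < e) sequentially"
      proof eventually_elim
        case (elim n)
        have "\<sigma> (Suc m) \<le> \<sigma> (Suc n)" using \<sigma>(1) elim by (auto simp: mono_def)
        show ?case
        proof
          fix z assume "z \<in> cball x d"
          then have "norm (g z - F n z) \<le> \<gamma> / 2 ^ n"
            using nz \<open>\<sigma> (Suc m) \<le> \<sigma> (Suc n)\<close> by (intro close) force
          then show "dist (F n z) (g z) < e"
            using elim(2) by (simp only: dist_norm norm_minus_commute)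
        qed
      qed
    qed
    moreover have "cball x d \<subseteq> ball 0 1" using nz \<sigma>(2)[of "Suc m"] by force
    moreover have "0 < d" using m by (simp add: d_def)
    ultimately show "\<exists>d>0. cball x d \<subseteq> ball 0 1 \<and> uniform_limit (cball x d) F g sequentially" by blast
  qed simp
  with close that show ?thesis by blast
qed

text \<open>
  Iterating \<open>lift_boundary\<close> from the zero pair gives pairs \<open>(F n, G n)\<close> and radii \<open>\<sigma> n\<close>. On the
  annulus \<open>\<sigma> (Suc k) \<le> |z| \<le> \<sigma> (Suc (Suc k))\<close> the pair with index \<open>Suc k\<close> has maximum at least
  \<open>k - 1\<close>, and all later changes together amount to at most \<open>\<gamma>\<close> there.
\<close>

lemma small_pair_with_large_max_Re:
  fixes r \<gamma> :: real
  assumes "0 < r" "r < 1" "0 < \<gamma>"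
  obtains g1 g2 where "g1 holomorphic_on ball 0 1" "g2 holomorphic_on ball 0 1"
    "\<And>z. norm z \<le> r \<Longrightarrow> norm (g1 z) \<le> \<gamma> \<and> norm (g2 z) \<le> \<gamma>"
    "\<And>K. \<exists>\<rho><1. \<forall>z. \<rho> \<le> norm z \<and> norm z < 1 \<longrightarrow> K \<le> max (Re (g1 z)) (Re (g2 z))"
proof -
  \<comment> \<open>\<open>P\<close> is the invariant of the \<open>n\<close>-th stage, a pair together with a radius, and \<open>Q\<close> relates
    consecutive stages. The lower bound \<open>1 - 1 / Suc n\<close> forces the radii to tend to \<open>1\<close>.\<close>
  define P where "P = (\<lambda>(n::nat) (F, G, \<sigma>::real). (n = 0 \<longrightarrow> F = (\<lambda>_. 0) \<and> G = (\<lambda>_. 0)) \<and> F holomorphic_on UNIV \<and> G holomorphic_on UNIV \<and>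
    (\<forall>z. norm z = 1 \<longrightarrow> real n \<le> max (Re (F z)) (Re (G z))) \<and> r \<le> \<sigma> \<and> 1 - 1 / real (Suc n) \<le> \<sigma> \<and> \<sigma> < 1)"
  define Q where "Q = (\<lambda>(n::nat) (F, G, \<sigma>::real) (F', G', \<sigma>'). \<sigma> \<le> \<sigma>' \<and>
    (\<forall>z::complex. norm z \<le> \<sigma>' \<longrightarrow> norm (F' z - F z) \<le> \<gamma> / 2 ^ Suc n \<and> norm (G' z - G z) \<le> \<gamma> / 2 ^ Suc n) \<and>
    (\<forall>z. \<sigma>' \<le> norm z \<and> norm z \<le> 1 \<longrightarrow> real n - 1 \<le> max (Re (F' z)) (Re (G' z))))"
  have "\<exists>s. \<forall>n. P n (s n) \<and> Q n (s n) (s (Suc n))"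
  proof (rule dependent_nat_choice)
    show "\<exists>s. P 0 s"
      using assms by (intro exI[of _ "(\<lambda>_. 0, \<lambda>_. 0, r)"]) (simp add: P_def)
    fix s n assume "P n s"
    obtain F G \<sigma> where s: "s = (F, G, \<sigma>)" by (cases s)
    have 1: "F holomorphic_on UNIV" "G holomorphic_on UNIV"
      and 2: "\<And>z. norm z = 1 \<Longrightarrow> real n \<le> max (Re (F z)) (Re (G z))" and 3: "r \<le> \<sigma>" "\<sigma> < 1"
      using \<open>P n s\<close> by (auto simp: P_def s)
    have e: "0 < min 1 (\<gamma> / 2 ^ Suc n)" using assms by simp
    have "max \<sigma> (1 - 1 / real (Suc (Suc n))) < 1" using 3 by simp
    from lift_boundary[OF 1 2 e this] obtain F' G' \<sigma>' where *:
      "F' holomorphic_on UNIV" "G' holomorphic_on UNIV" "max \<sigma> (1 - 1 / real (Suc (Suc n))) < \<sigma>'" "\<sigma>' < 1"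
      "\<And>z. norm z \<le> \<sigma>' \<Longrightarrow> norm (F' z - F z) < min 1 (\<gamma> / 2 ^ Suc n) \<and> norm (G' z - G z) < min 1 (\<gamma> / 2 ^ Suc n)"
      "\<And>z. \<sigma>' \<le> norm z \<Longrightarrow> norm z \<le> 1 \<Longrightarrow> real n - min 1 (\<gamma> / 2 ^ Suc n) \<le> max (Re (F' z)) (Re (G' z))"
      "\<And>z. norm z = 1 \<Longrightarrow> real n + 1 \<le> max (Re (F' z)) (Re (G' z))"
      by metis
    have "P (Suc n) (F', G', \<sigma>')"
      using * 3 by (force simp: P_def)
    moreover have "Q n s (F', G', \<sigma>')"
      unfolding Q_def s prod.case
    proof (intro conjI allI impI)
      show "\<sigma> \<le> \<sigma>'" using *(3) by simp
    next
      fix z :: complex assume "norm z \<le> \<sigma>'"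
      from *(5)[OF this] show "norm (F' z - F z) \<le> \<gamma> / 2 ^ Suc n" "norm (G' z - G z) \<le> \<gamma> / 2 ^ Suc n"
        by linarith+
    next
      fix z :: complex assume "\<sigma>' \<le> norm z \<and> norm z \<le> 1"
      with *(6)[of z] show "real n - 1 \<le> max (Re (F' z)) (Re (G' z))" by linarith
    qed
    ultimately show "\<exists>s'. P (Suc n) s' \<and> Q n s s'" by blast
  qed
  then obtain s where s: "\<And>n. P n (s n)" "\<And>n. Q n (s n) (s (Suc n))" by blast
  define F where "F = (\<lambda>n. fst (s n))"
  define G where "G = (\<lambda>n. fst (snd (s n)))"
  define \<sigma> where "\<sigma> = (\<lambda>n. snd (snd (s n)))"
  have sn: "s n = (F n, G n, \<sigma> n)" for n by (simp add: F_def G_def \<sigma>_def)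
  note s' = s(1)[unfolded P_def sn] s(2)[unfolded Q_def sn]
  have hol: "F n holomorphic_on UNIV" "G n holomorphic_on UNIV" for n using s'(1)[of n] by auto
  have mono: "mono \<sigma>" using s'(2) by (auto intro: incseq_SucI)
  have \<sigma>1: "\<sigma> n < 1" and r\<sigma>: "r \<le> \<sigma> n" and \<sigma>lb: "1 - 1 / real (Suc n) \<le> \<sigma> n" for n
    using s'(1)[of n] by auto
  have \<sigma>lim: "\<sigma> \<longlonglongrightarrow> 1"
  proof (rule tendsto_sandwich)
    show "(\<lambda>n. 1 - 1 / real (Suc n)) \<longlonglongrightarrow> 1"
      using tendsto_diff[OF tendsto_const[of 1] LIMSEQ_inverse_real_of_nat] by (simp add: inverse_eq_divide)
  qed (use \<sigma>1 \<sigma>lb in \<open>auto simp: less_imp_le\<close>)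
  have stepF: "norm (F (Suc n) z - F n z) \<le> \<gamma> / 2 ^ Suc n"
    and stepG: "norm (G (Suc n) z - G n z) \<le> \<gamma> / 2 ^ Suc n" if "norm z \<le> \<sigma> (Suc n)" for n z
    using s'(2)[of n] that by auto
  have big: "real n - 1 \<le> max (Re (F (Suc n) z)) (Re (G (Suc n) z))"
    if "\<sigma> (Suc n) \<le> norm z" "norm z \<le> 1" for n z
    using s'(2)[of n] that by auto
  obtain g1 where g1: "g1 holomorphic_on ball 0 1"
    "\<And>n z. norm z \<le> \<sigma> (Suc n) \<Longrightarrow> norm (g1 z - F n z) \<le> \<gamma> / 2 ^ n"
    using telescoping_locally_uniform_limit[where F = F and \<sigma> = \<sigma>, OF hol(1) less_imp_le[OF assms(3)] mono \<sigma>1 \<sigma>lim stepF] by metis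
  obtain g2 where g2: "g2 holomorphic_on ball 0 1"
    "\<And>n z. norm z \<le> \<sigma> (Suc n) \<Longrightarrow> norm (g2 z - G n z) \<le> \<gamma> / 2 ^ n"
    using telescoping_locally_uniform_limit[where F = G and \<sigma> = \<sigma>, OF hol(2) less_imp_le[OF assms(3)] mono \<sigma>1 \<sigma>lim stepG] by metis
  have \<gamma>n: "\<gamma> / 2 ^ n \<le> \<gamma>" for n
    using assms(3) by (simp add: field_simps)
  show ?thesis
  proof (rule that[OF g1(1) g2(1)])
    show "norm (g1 z) \<le> \<gamma> \<and> norm (g2 z) \<le> \<gamma>" if "norm z \<le> r" for z
    proof -
      have "norm z \<le> \<sigma> (Suc 0)" using that r\<sigma>[of "Suc 0"] by simp
      moreover have "F 0 z = 0" "G 0 z = 0" using s'(1)[of 0] by auto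
      ultimately show ?thesis using g1(2)[of z 0] g2(2)[of z 0] by simp
    qed
    fix K :: real
    obtain N :: nat where N: "K + \<gamma> + 1 \<le> real N" using real_arch_simple by blast
    have "K \<le> max (Re (g1 z)) (Re (g2 z))" if z: "\<sigma> (Suc N) \<le> norm z" "norm z < 1" for z
    proof -
      have "eventually (\<lambda>n. norm z < \<sigma> n) sequentially" using \<sigma>lim z(2) by (rule order_tendstoD)
      then have ex: "\<exists>n. norm z < \<sigma> n" using eventually_happens' sequentially_bot by blast
      \<comment> \<open>Locate the annulus containing \<open>z\<close>.\<close>
      define j where "j = (LEAST n. norm z < \<sigma> n)"
      have j: "norm z < \<sigma> j" and less: "\<And>i. i < j \<Longrightarrow> \<sigma> i \<le> norm z"
        unfolding j_def using LeastI_ex[OF ex] by (auto dest: not_less_Least simp: not_less)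
      have "Suc N < j"
      proof (rule ccontr)
        assume "\<not> Suc N < j"
        then have "\<sigma> j \<le> \<sigma> (Suc N)" using mono by (simp add: monoD)
        then show False using j z(1) by linarith
      qed
      then obtain k where k: "j = Suc (Suc k)" "N \<le> k"
        using that[of "j - 2"] by simp
      have "real k - 1 \<le> max (Re (F (Suc k) z)) (Re (G (Suc k) z))"
        using less[of "Suc k"] k z by (intro big) auto
      moreover have "norm (g1 z - F (Suc k) z) \<le> \<gamma>" "norm (g2 z - G (Suc k) z) \<le> \<gamma>"
        using g1(2)[of z "Suc k"] g2(2)[of z "Suc k"] j k \<gamma>n[of "Suc k"] by auto
      then have "Re (F (Suc k) z) \<le> Re (g1 z) + \<gamma>" "Re (G (Suc k) z) \<le> Re (g2 z) + \<gamma>"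
        using abs_Re_le_cmod[of "g1 z - F (Suc k) z"] abs_Re_le_cmod[of "g2 z - G (Suc k) z"] by auto
      ultimately show ?thesis using N k(2) by (simp add: max_def split: if_splits)
    qed
    then show "\<exists>\<rho><1. \<forall>z. \<rho> \<le> norm z \<and> norm z < 1 \<longrightarrow> K \<le> max (Re (g1 z)) (Re (g2 z))"
      using \<sigma>1[of "Suc N"] by blast
  qed
qed

section \<open>Proper discs with zero-free components near the circle\<close>

theorem theorem4p1:
  fixes h :: "complex \<Rightarrow> complex ^ 'n" and r \<epsilon> :: real
  assumes "CARD('n) \<ge> 2"
    and "continuous_on (cball 0 1) h"
    and "h holomorphic_map_on ball 0 1"
    and "0 < r" and "r < 1"
    and "\<And>j z. r \<le> norm z \<Longrightarrow> norm z \<le> 1 \<Longrightarrow> h z $ j \<noteq> 0"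
    and "\<epsilon> > 0"
  shows "\<exists>f :: complex \<Rightarrow> complex ^ 'n.
           f holomorphic_map_on ball 0 1 \<and>
           proper_on_disc f \<and>
           (\<forall>j z. r \<le> norm z \<and> norm z < 1 \<longrightarrow> f z $ j \<noteq> 0) \<and>
           (\<forall>z. norm z \<le> r \<longrightarrow> norm (f z - h z) < \<epsilon>)"
proof -
  obtain p q :: 'n where pq: "p \<noteq> q"
  proof -
    have "\<not> card (UNIV :: 'n set) \<le> Suc 0" using assms(1) by simp
    then show ?thesis using that by (subst (asm) card_le_Suc0_iff_eq) auto
  qed
  have "bounded (h ` cball 0 1)"
    by (intro compact_imp_bounded compact_continuous_image assms compact_cball)
  then obtain B where B: "0 < B" "\<And>z. norm z \<le> 1 \<Longrightarrow> norm (h z) \<le> B"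
    unfolding bounded_pos by auto
  define A where "A = {z::complex. r \<le> norm z \<and> norm z \<le> 1}"
  have "A = cball 0 1 - ball 0 r" by (auto simp: A_def)
  then have "compact A" by (simp add: compact_diff)
  have lower: "\<exists>c>0. \<forall>z\<in>A. c \<le> norm (h z $ j)" for j
  proof -
    have "A \<noteq> {}" using assms(4,5) by (auto simp: A_def intro!: exI[of _ 1])
    moreover have "continuous_on A (\<lambda>z. norm (h z $ j))"
      by (intro continuous_intros continuous_on_subset[OF assms(2)]) (auto simp: A_def)
    ultimately obtain w where "w \<in> A" "\<forall>z\<in>A. norm (h w $ j) \<le> norm (h z $ j)"
      using continuous_attains_inf[OF \<open>compact A\<close>] by blast
    moreover have "0 < norm (h w $ j)" using assms(6)[of w j] \<open>w \<in> A\<close> by (simp add: A_def)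
    ultimately show ?thesis by blast
  qed
  obtain c0 c1 where c01: "c0 > 0" "\<forall>z\<in>A. c0 \<le> norm (h z $ p)" "c1 > 0" "\<forall>z\<in>A. c1 \<le> norm (h z $ q)"
    using lower[of p] lower[of q] by blast
  define c where "c = min c0 c1"
  have c: "0 < c" "\<And>z. z \<in> A \<Longrightarrow> c \<le> norm (h z $ p)" "\<And>z. z \<in> A \<Longrightarrow> c \<le> norm (h z $ q)"
    using c01 by (auto simp: c_def min_le_iff_disj)
  define \<delta> where "\<delta> = \<epsilon> / (2 * B * CARD('n))"
  have \<delta>: "0 < \<delta>" using assms(1,7) B by (simp add: \<delta>_def)
  have "isCont exp (0::complex)" by simp
  then obtain \<gamma>' where \<gamma>': "0 < \<gamma>'" "\<And>w::complex. norm w < \<gamma>' \<Longrightarrow> norm (exp w - 1) < \<delta>"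
    unfolding continuous_at_eps_delta using \<delta> by (fastforce simp: dist_norm)
  define \<gamma> where "\<gamma> = \<gamma>' / 2"
  have \<gamma>: "0 < \<gamma>" "\<And>w::complex. norm w \<le> \<gamma> \<Longrightarrow> norm (exp w - 1) \<le> \<delta>"
    using \<gamma>' by (auto simp: \<gamma>_def intro!: less_imp_le)
  obtain g1 g2 where g: "g1 holomorphic_on ball 0 1" "g2 holomorphic_on ball 0 1"
    "\<And>z. norm z \<le> r \<Longrightarrow> norm (g1 z) \<le> \<gamma> \<and> norm (g2 z) \<le> \<gamma>"
    "\<And>K. \<exists>\<rho><1. \<forall>z. \<rho> \<le> norm z \<and> norm z < 1 \<longrightarrow> K \<le> max (Re (g1 z)) (Re (g2 z))"
    using small_pair_with_large_max_Re[OF assms(4,5) \<gamma>(1)] by metis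
  define G where "G = (\<lambda>j. if j = p then g1 else g2)"
  define f where "f = (\<lambda>z. \<chi> j. h z $ j * exp (G j z))"
  have f: "f z $ j = h z $ j * exp (G j z)" for z j by (simp add: f_def)
  have holG: "G j holomorphic_on ball 0 1" for j using g by (simp add: G_def)
  have "f holomorphic_map_on ball 0 1"
    unfolding holomorphic_map_on_def f using assms(3) holG
    by (auto simp: holomorphic_map_on_def intro!: holomorphic_intros)
  moreover have "proper_on_disc f"
    unfolding proper_on_disc_def filterlim_at_top_ge[where c = 1]
  proof (intro allI impI)
    fix Z :: real assume "1 \<le> Z"
    obtain \<rho> where \<rho>: "\<rho> < 1"
      "\<And>z. \<rho> \<le> norm z \<Longrightarrow> norm z < 1 \<Longrightarrow> ln (Z / c) \<le> max (Re (g1 z)) (Re (g2 z))"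
      using g(4)[of "ln (Z / c)"] by blast
    have "Z \<le> norm (f z)" if z: "max \<rho> r < norm z" "norm z < 1" for z
    proof -
      have zA: "z \<in> A" using z by (simp add: A_def)
      have "\<exists>j. ln (Z / c) \<le> Re (G j z) \<and> c \<le> norm (h z $ j)"
      proof (cases "ln (Z / c) \<le> Re (g1 z)")
        case True
        then show ?thesis using c(2)[OF zA] by (intro exI[of _ p]) (simp add: G_def)
      next
        case False
        then have "ln (Z / c) \<le> Re (g2 z)" using \<rho>(2)[of z] z by auto
        then show ?thesis using c(3)[OF zA] pq by (intro exI[of _ q]) (auto simp: G_def)
      qed
      then obtain j where j: "ln (Z / c) \<le> Re (G j z)" "c \<le> norm (h z $ j)" by blast
      have "Z = c * exp (ln (Z / c))" using \<open>1 \<le> Z\<close> c(1) by simp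
      also have "\<dots> \<le> norm (h z $ j) * exp (Re (G j z))"
        using j c(1) by (intro mult_mono) auto
      also have "\<dots> = norm (f z $ j)" by (simp add: f norm_mult)
      also have "\<dots> \<le> norm (f z)" by (rule Finite_Cartesian_Product.norm_nth_le)
      finally show ?thesis .
    qed
    moreover have "eventually (\<lambda>t. max \<rho> r < t \<and> t < 1) (at_left (1::real))"
      unfolding eventually_at_left_field using \<rho>(1) assms(5) by (intro exI[of _ "max \<rho> r"]) auto
    ultimately show "eventually (\<lambda>z. Z \<le> norm (f z)) (filtercomap norm (at_left 1))"
      unfolding eventually_filtercomap by blast
  qed
  moreover have "\<forall>j z. r \<le> norm z \<and> norm z < 1 \<longrightarrow> f z $ j \<noteq> 0"
    using assms(6) by (simp add: f)
  moreover have "norm (f z - h z) < \<epsilon>" if z: "norm z \<le> r" for z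
  proof -
    have "norm ((f z - h z) $ j) \<le> B * \<delta>" for j
    proof -
      have "norm (h z $ j) \<le> B"
        using B(2)[of z] z assms(5) Finite_Cartesian_Product.norm_nth_le[of "h z" j] by linarith
      moreover have "norm (exp (G j z) - 1) \<le> \<delta>"
        using g(3)[OF z] \<gamma>(2) by (simp add: G_def)
      moreover have "(f z - h z) $ j = h z $ j * (exp (G j z) - 1)"
        by (simp add: f algebra_simps)
      ultimately show ?thesis
        using B(1) by (simp add: norm_mult mult_mono)
    qed
    then have "(\<Sum>j\<in>UNIV. norm ((f z - h z) $ j)) \<le> real CARD('n) * (B * \<delta>)"
      by (rule sum_bounded_above)
    also have "\<dots> < \<epsilon>" using B(1) assms(1,7) by (simp add: \<delta>_def field_simps)
    finally show ?thesis
      unfolding norm_vec_def using L2_set_le_sum[of UNIV "\<lambda>j. norm ((f z - h z) $ j)"] by force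
  qed
  ultimately show ?thesis by blast
qed

end
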